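(* Let $f:\mathcal{S}\to\mathbb{R}\cup\{+\infty\}$ be proper, closed and convex, with $\mathcal{X}_\star\neq\emptyset$. Let $\{t_k\}_{k\ge 0}$ be any sequence of positive real numbers, let $x_0\in\operatorname{dom} f$, and let $\{x_k\}_{k\ge 0}$ be iterates of the Non-Euclidean Broximal Point Method, i.e. for every $k\ge 0$ $$x_{k+1}\in\operatorname*{arg\,min}_{z\in\mathcal{B}(x_k,t_k)} f(z).$$ Then: (i) For every $k\ge0$, if $\mathcal{X}_\star\cap\mathcal{B}(x_k,t_k)\neq\emptyset$, then $x_{k+1}\in\mathcal{X}_\star$. (ii) For every $k\ge0$, if $\mathcal{X}_\star\cap\mathcal{B}(x_k,t_k)=\emptyset$, then $\|x_{k+1}-x_k\|=t_k$. (iii) For every $k\ge 0$ and every $x_\star\in\mathcal{X}_\star$, $$f(x_{k+1})-f_\star\le\left(1+\frac{t_k}{\|x_{k+1}-x_\star\|}\right)^{-1}\left(f(x_k)-f_\star\right),$$ where the factor $\left(1+\frac{t_k}{\|x_{k+1}-x_\star\|}\right)^{-1}$ is read as $0$ if $x_{k+1}=x_\star$. (iv) If $f$ is differentiable (on all of $\mathcal{S}$, in particular finite-valued), then $\|\nabla f(x_{k+1})\|_\star\le\|\nabla f(x_k)\|_\star$ for all $k\ge 0$, and for every integer $K\ge 1$, $$\sum_{k=0}^{K-1}\left(\frac{t_k}{\sum_{j=0}^{K-1}t_j}\,\|\nabla f(x_{k+1})\|_\star\right)\le\frac{f(x_0)-f_\star}{\sum_{k=0}^{K-1}t_k}.$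$
   Context: $\mathcal{S}$ is a finite-dimensional real vector space with an inner product $\langle\cdot,\cdot\rangle$, additionally equipped with an arbitrary norm $\|\cdot\|$ (not necessarily induced by the inner product). The dual norm is $\|x\|_\star:=\sup_{\|z\|\le1}\langle x,z\rangle$. The gradient $\nabla f$ is taken with respect to $\langle\cdot,\cdot\rangle$. The closed ball is $\mathcal{B}(x,t):=\{z\in\mathcal{S}:\|z-x\|\le t\}$. For $f:\mathcal{S}\to\mathbb{R}\cup\{+\infty\}$, $\operatorname{dom} f:=\{x\in\mathcal{S}: f(x)<+\infty\}$; $f$ is proper if $\operatorname{dom} f\neq\emptyset$, and closed if its epigraph is closed (equivalently, $f$ is lower semicontinuous). $f_\star:=\inf_{x\in\mathcal{S}}f(x)$, and $\mathcal{X}_\star$ is the set of (global) minimizers of $f$ over $\mathcal{S}$. When the minimizer over the ball is not unique, $x_{k+1}$ is an arbitrary minimizer. *)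

theory Defs
  imports "HOL-Analysis.Analysis"
begin

text \<open>
  The underlying space is a type of class \<open>real_inner\<close> that is assumed to be spanned by a finite
  set; unlike \<open>euclidean_space\<close> this includes the zero space. The additional norm is a function
  \<open>N\<close>, unrelated to the norm of the type class, which only serves to provide the (canonical)
  topology and the Frechet derivative.
\<close>

definition finite_dim :: "'a::real_vector itself \<Rightarrow> bool" where
  "finite_dim _ \<longleftrightarrow> (\<exists>B :: 'a set. finite B \<and> span B = UNIV)"

definition is_norm :: "('a::real_vector \<Rightarrow> real) \<Rightarrow> bool" where
  "is_norm N \<longleftrightarrow>
     (\<forall>x. 0 \<le> N x) \<and> (\<forall>x. N x = 0 \<longleftrightarrow> x = 0) \<and>
     (\<forall>c x. N (c *\<^sub>R x) = \<bar>c\<bar> * N x) \<and> (\<forall>x y. N (x + y) \<le> N x + N y)"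

definition norm_ball :: "('a::real_vector \<Rightarrow> real) \<Rightarrow> 'a \<Rightarrow> real \<Rightarrow> 'a set" where
  "norm_ball N x t = {z. N (z - x) \<le> t}"

text \<open>The supremum is taken in the reals; it is finite because the space is finite-dimensional.\<close>

definition dual_norm :: "('a::real_inner \<Rightarrow> real) \<Rightarrow> 'a \<Rightarrow> real" where
  "dual_norm N x = (SUP z\<in>{z. N z \<le> 1}. x \<bullet> z)"

definition edom :: "('a \<Rightarrow> ereal) \<Rightarrow> 'a set" where
  "edom f = {x. f x < \<infinity>}"

definition epi :: "('a \<Rightarrow> ereal) \<Rightarrow> ('a \<times> real) set" where
  "epi f = {(x, r). f x \<le> ereal r}"

definition closed_fun :: "('a::topological_space \<Rightarrow> ereal) \<Rightarrow> bool" where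
  "closed_fun f \<longleftrightarrow> closed (epi f)"

text \<open>
  The sum on the right is well behaved only for functions avoiding \<open>-\<infinity>\<close>, which is a separate
  assumption wherever this notion is used. For \<open>u = 0\<close> and \<open>u = 1\<close> the convention
  \<open>0 * \<infinity> = 0\<close> makes the inequality trivial.
\<close>

definition convex_fun :: "('a::real_vector \<Rightarrow> ereal) \<Rightarrow> bool" where
  "convex_fun f \<longleftrightarrow>
     (\<forall>x y u. 0 \<le> u \<and> u \<le> 1 \<longrightarrow>
        f ((1 - u) *\<^sub>R x + u *\<^sub>R y) \<le> ereal (1 - u) * f x + ereal u * f y)"

definition argmin_on :: "('a \<Rightarrow> ereal) \<Rightarrow> 'a set \<Rightarrow> 'a set" where
  "argmin_on f S = {z. is_arg_min f (\<lambda>w. w \<in> S) z}"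

definition minimizers :: "('a \<Rightarrow> ereal) \<Rightarrow> 'a set" where
  "minimizers f = argmin_on f UNIV"

definition min_value :: "('a \<Rightarrow> ereal) \<Rightarrow> ereal" where
  "min_value f = (INF x. f x)"

definition broximal_iterates ::
  "('a::real_vector \<Rightarrow> real) \<Rightarrow> ('a \<Rightarrow> ereal) \<Rightarrow> (nat \<Rightarrow> real) \<Rightarrow> (nat \<Rightarrow> 'a) \<Rightarrow> bool" where
  "broximal_iterates N f t x \<longleftrightarrow>
     (\<forall>k. x (Suc k) \<in> argmin_on f (norm_ball N (x k) (t k)))"

definition differentiable_fun :: "('a::real_normed_vector \<Rightarrow> ereal) \<Rightarrow> bool" where
  "differentiable_fun f \<longleftrightarrow>
     (\<forall>x. \<bar>f x\<bar> \<noteq> \<infinity>) \<and> (\<forall>x. (\<lambda>y. real_of_ereal (f y)) differentiable (at x))"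

text \<open>
  The gradient with respect to the inner product of the type, meaningful only where \<open>f\<close> is
  finite and differentiable.
\<close>

definition grad :: "('a::real_inner \<Rightarrow> ereal) \<Rightarrow> 'a \<Rightarrow> 'a" where
  "grad f x = (THE D. GDERIV (\<lambda>y. real_of_ereal (f y)) x :> D)"

end

theory Submission
  imports Defs
begin

text \<open>
  Convexity along the segment from an iterate to a minimizer gives (ii) and (iii): for (ii) one
  moves slightly from \<open>x (Suc k)\<close>, for (iii) one moves from \<open>x k\<close> by exactly \<open>t k\<close>. For (iv), with
  \<open>g k\<close> the gradient at \<open>x k\<close>, optimality on the ball and the gradient inequality at both points give
  \<open>t k * dual_norm N (g (Suc k)) \<le> f (x k) - f (x (Suc k)) \<le> t k * dual_norm N (g k)\<close>;
  the left half telescopes. The right half needs the set in the definition of \<open>dual_norm\<close> to be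
  bounded, hence the comparison of \<open>N\<close> with the norm of the type by compactness of the sphere.
\<close>

section \<open>Elementary consequences of the norm axioms\<close>

lemma is_normD:
  assumes "is_norm N"
  shows is_norm_ge_0: "0 \<le> N x"
    and is_norm_eq_0: "N x = 0 \<longleftrightarrow> x = 0"
    and is_norm_scale: "N (c *\<^sub>R x) = \<bar>c\<bar> * N x"
    and is_norm_triangle: "N (x + y) \<le> N x + N y"
  using assms unfolding is_norm_def by blast+

lemma is_norm_zero: "is_norm N \<Longrightarrow> N 0 = 0"
  by (simp add: is_norm_eq_0)

lemma is_norm_minus: "is_norm N \<Longrightarrow> N (- x) = N x"
  using is_norm_scale[of N "-1" x] by simp

lemma is_norm_minus_commute: "is_norm N \<Longrightarrow> N (x - y) = N (y - x)"
  using is_norm_minus[of N "x - y"] by simp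

lemma is_norm_sum:
  assumes "is_norm N" "finite A"
  shows "N (\<Sum>a\<in>A. g a) \<le> (\<Sum>a\<in>A. N (g a))"
  using assms(2)
proof (induction A rule: finite_induct)
  case (insert a A)
  then show ?case
    using is_norm_triangle[OF assms(1), of "g a" "sum g A"] by simp
qed (simp add: is_norm_zero[OF assms(1)])

subsection \<open>Finite-dimensional inner product spaces\<close>

text \<open>Gram-Schmidt makes a finite spanning set orthogonal; dropping 0 and normalising keeps
  the span. In the zero space the result is empty.\<close>

lemma finite_dim_orthonormal_basis:
  assumes "finite_dim TYPE('a::real_inner)"
  obtains C :: "'a::real_inner set" where "finite C" "pairwise orthogonal C" "\<And>c. c \<in> C \<Longrightarrow> norm c = 1"
    "span C = UNIV"
proof -
  obtain B :: "'a set" where B: "finite B" "span B = UNIV"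
    using assms unfolding finite_dim_def by blast
  obtain D where D: "finite D" "span D = span B" "pairwise orthogonal D"
    using basis_orthogonal[OF B(1)] by blast
  define C where "C = (\<lambda>d. d /\<^sub>R norm d) ` (D - {0})"
  have "finite C"
    using D(1) by (simp add: C_def)
  moreover have "pairwise orthogonal C"
    using D(3) by (auto simp: pairwise_def orthogonal_def C_def)
  moreover have "norm c = 1" if "c \<in> C" for c
  proof -
    from that obtain d where "d \<noteq> 0" "c = d /\<^sub>R norm d"
      by (auto simp: C_def)
    then show ?thesis
      by simp
  qed
  moreover have "span C = UNIV"
  proof -
    have "d \<in> span C" if "d \<in> D" for d
    proof (cases "d = 0")
      case False
      then have "d /\<^sub>R norm d \<in> span C"
        using that by (auto simp: C_def intro: span_base)
      then have "norm d *\<^sub>R (d /\<^sub>R norm d) \<in> span C"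
        by (rule span_scale)
      then show ?thesis
        using False by simp
    qed (simp add: span_zero)
    then have "D \<subseteq> span C"
      by (rule subsetI)
    then have "span D \<subseteq> span C"
      by (rule span_minimal) (rule subspace_span)
    then show ?thesis
      unfolding D(2) B(2) by (rule top.extremum_uniqueI)
  qed
  ultimately show thesis
    by (rule that)
qed

text \<open>Both sides are linear in \<open>v\<close> and agree on \<open>C\<close> by
  orthonormality. Taking the identity for \<open>L\<close> gives the coordinate expansion of
  \<open>v\<close>.\<close>

lemma orthonormal_basis_linear_eq:
  fixes C :: "'a::real_inner set" and L :: "'a \<Rightarrow> 'b::real_vector"
  assumes "finite C" "pairwise orthogonal C" "\<And>c. c \<in> C \<Longrightarrow> norm c = 1" "span C = UNIV"
    and "linear L"
  shows "L v = (\<Sum>c\<in>C. (v \<bullet> c) *\<^sub>R L c)"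
proof (rule linear_eq_on_span[OF assms(5)])
  show "linear (\<lambda>v. \<Sum>c\<in>C. (v \<bullet> c) *\<^sub>R L c)"
    by (rule linearI)
      (simp_all add: inner_add_left scaleR_add_left sum.distrib scaleR_sum_right)
  show "v \<in> span C"
    using assms by simp
  fix c assume c: "c \<in> C"
  have "(\<Sum>d\<in>C. (c \<bullet> d) *\<^sub>R L d) = (\<Sum>d\<in>C. if d = c then L d else 0)"
    using assms(2) assms(3)[OF c] c
    by (intro sum.cong) (auto simp: pairwise_def orthogonal_def norm_eq_1)
  then show "L c = (\<Sum>d\<in>C. (c \<bullet> d) *\<^sub>R L d)"
    using assms(1) c by simp
qed

text \<open>The expansion of \<open>L h\<close> exhibits
  \<open>\<Sum>c\<in>C. L c *\<^sub>R c\<close> as representing vector. This turns a Frechet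
  derivative into a gradient.\<close>

lemma finite_dim_riesz:
  fixes L :: "'a::real_inner \<Rightarrow> real"
  assumes "finite_dim TYPE('a)" "linear L"
  obtains D where "\<And>h. L h = h \<bullet> D"
proof -
  obtain C :: "'a set" where C: "finite C" "pairwise orthogonal C"
    "\<And>c. c \<in> C \<Longrightarrow> norm c = 1" "span C = UNIV"
    by (rule finite_dim_orthonormal_basis[OF assms(1)]) blast
  have "L h = h \<bullet> (\<Sum>c\<in>C. L c *\<^sub>R c)" for h
    using orthonormal_basis_linear_eq[OF C assms(2), of h]
    by (simp add: inner_sum_right mult.commute)
  then show thesis
    using that by blast
qed

text \<open>Unit vectors have coordinates in [-1,1], so the sphere is a closed subset of the
  continuous image of a cube, which is compact by Tychonoff.\<close>

lemma finite_dim_compact_sphere: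
  assumes "finite_dim TYPE('a::real_inner)"
  shows "compact (sphere (0::'a) 1)"
proof -
  obtain C :: "'a set" where C: "finite C" "pairwise orthogonal C"
    "\<And>c. c \<in> C \<Longrightarrow> norm c = 1" "span C = UNIV"
    by (rule finite_dim_orthonormal_basis[OF assms]) blast
  \<comment> \<open>The cube is indexed by the whole type, so that its topology is that of the
    function type; \<open>F\<close> reads only the coordinates in \<open>C\<close>.\<close>
  define Q :: "('a \<Rightarrow> real) set" where "Q = (\<Pi>\<^sub>E c\<in>UNIV. {-1..1})"
  define F :: "('a \<Rightarrow> real) \<Rightarrow> 'a" where "F a = (\<Sum>c\<in>C. a c *\<^sub>R c)" for a
  have "compactin (product_topology (\<lambda>_. euclidean) UNIV) Q"
    unfolding Q_def compactin_PiE by simp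
  then have "compact Q"
    by (simp add: euclidean_product_topology)
  moreover have "continuous_on Q F"
    unfolding F_def
    by (intro continuous_intros continuous_on_subset[OF continuous_on_product_coordinates]) auto
  ultimately have "compact (F ` Q)"
    by (intro compact_continuous_image)
  moreover have "sphere 0 1 \<subseteq> F ` Q"
  proof
    fix v :: 'a assume v: "v \<in> sphere 0 1"
    \<comment> \<open>Outside \<open>C\<close> the number \<open>v \<bullet> c\<close> may leave
      [-1,1], hence the default 0.\<close>
    have "v = F (\<lambda>c. if c \<in> C then v \<bullet> c else 0)"
      using orthonormal_basis_linear_eq[OF C linear_id, of v] by (simp add: F_def)
    moreover have "\<bar>v \<bullet> c\<bar> \<le> 1" if "c \<in> C" for c
      using Cauchy_Schwarz_ineq2[of v c] C(3)[OF that] v by simp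
    ultimately show "v \<in> F ` Q"
      by (intro image_eqI) (auto simp: Q_def abs_le_iff)
  qed
  moreover have "closed (sphere (0::'a) 1)"
    unfolding sphere_def by (intro closed_Collect_eq continuous_intros)
  ultimately show ?thesis
    using compact_Int_closed[of "F ` Q" "sphere 0 1"] by (simp add: Int_absorb1)
qed

lemma finite_dim_is_norm_le_norm:
  fixes N :: "'a::real_inner \<Rightarrow> real"
  assumes "finite_dim TYPE('a)" "is_norm N"
  obtains M where "0 \<le> M" "\<And>v. N v \<le> M * norm v"
proof -
  obtain C :: "'a set" where C: "finite C" "pairwise orthogonal C"
    "\<And>c. c \<in> C \<Longrightarrow> norm c = 1" "span C = UNIV"
    by (rule finite_dim_orthonormal_basis[OF assms(1)]) blast
  have "N v \<le> (\<Sum>c\<in>C. N c) * norm v" for v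
  proof -
    have "N v = N (\<Sum>c\<in>C. (v \<bullet> c) *\<^sub>R c)"
      using orthonormal_basis_linear_eq[OF C linear_id, of v] by simp
    also have "\<dots> \<le> (\<Sum>c\<in>C. \<bar>v \<bullet> c\<bar> * N c)"
      using is_norm_sum[OF assms(2) C(1), of "\<lambda>c. (v \<bullet> c) *\<^sub>R c"]
      by (simp add: is_norm_scale[OF assms(2)])
    also have "\<dots> \<le> (\<Sum>c\<in>C. norm v * N c)"
    proof (intro sum_mono mult_right_mono is_norm_ge_0[OF assms(2)])
      show "\<bar>v \<bullet> c\<bar> \<le> norm v" if "c \<in> C" for c
        using Cauchy_Schwarz_ineq2[of v c] C(3)[OF that] by simp
    qed
    finally show ?thesis
      by (simp add: sum_distrib_left mult.commute)
  qed
  moreover have "0 \<le> (\<Sum>c\<in>C. N c)"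
    using is_norm_ge_0[OF assms(2)] by (rule sum_nonneg)
  ultimately show thesis
    by (rule that[rotated])
qed

text \<open>The reverse comparison makes \<open>N\<close> Lipschitz, so \<open>N\<close> attains a
  positive minimum on the compact unit sphere; homogeneity gives its inverse as the
  constant.\<close>

lemma finite_dim_norm_le_is_norm:
  fixes N :: "'a::real_inner \<Rightarrow> real"
  assumes "finite_dim TYPE('a)" "is_norm N"
  obtains M where "0 \<le> M" "\<And>v. norm v \<le> M * N v"
proof (cases "sphere (0::'a) 1 = {}")
  \<comment> \<open>This is the zero space, where no minimum over the sphere exists.\<close>
  case True
  have "norm v \<le> 0 * N v" for v :: 'a
  proof (rule ccontr)
    assume "\<not> norm v \<le> 0 * N v"
    then have "v /\<^sub>R norm v \<in> sphere 0 1"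
      by simp
    then show False
      using True by blast
  qed
  then show thesis
    by (rule that[OF order_refl])
next
  case False
  obtain M where M: "0 \<le> M" "\<And>v. N v \<le> M * norm v"
    by (rule finite_dim_is_norm_le_norm[OF assms]) blast
  have "\<bar>N v - N w\<bar> \<le> M * norm (v - w)" for v w
    using is_norm_triangle[OF assms(2), of "v - w" w] is_norm_triangle[OF assms(2), of "w - v" v]
      M(2)[of "v - w"] is_norm_minus_commute[OF assms(2), of v w]
    unfolding diff_add_cancel by linarith
  then have "M-lipschitz_on (sphere 0 1) N"
    using M(1) by (intro lipschitz_onI) (simp_all add: dist_norm)
  then have "continuous_on (sphere 0 1) N"
    by (rule lipschitz_on_continuous_on)
  then obtain v0 where v0: "v0 \<in> sphere 0 1" "\<And>v. v \<in> sphere 0 1 \<Longrightarrow> N v0 \<le> N v"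
    using continuous_attains_inf[OF finite_dim_compact_sphere[OF assms(1)] False] by blast
  have "N v0 \<noteq> 0"
    using v0(1) unfolding is_norm_eq_0[OF assms(2)] by auto
  then have pos: "0 < N v0"
    using is_norm_ge_0[OF assms(2), of v0] by simp
  have "norm v \<le> inverse (N v0) * N v" for v
  proof (cases "v = 0")
    case False
    then have "N v0 \<le> N (v /\<^sub>R norm v)"
      by (intro v0) simp
    also have "\<dots> = N v / norm v"
      by (simp add: is_norm_scale[OF assms(2)] field_simps)
    finally show ?thesis
      using False pos by (simp add: field_simps)
  qed (simp add: is_norm_zero[OF assms(2)])
  moreover have "0 \<le> inverse (N v0)"
    using pos by simp
  ultimately show thesis
    by (rule that[rotated])
qed

section \<open>Dual norm and gradient\<close>

text \<open>Rescale \<open>w\<close> to the unit sphere of \<open>N\<close>. The real supremum is an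
  upper bound only for a bounded set; boundedness comes from Cauchy-Schwarz and the comparison of
  norms.\<close>

lemma inner_le_dual_norm:
  fixes N :: "'a::real_inner \<Rightarrow> real"
  assumes "finite_dim TYPE('a)" "is_norm N"
  shows "g \<bullet> w \<le> dual_norm N g * N w"
proof (cases "w = 0")
  case False
  obtain M where M: "0 \<le> M" "\<And>v. norm v \<le> M * N v"
    by (rule finite_dim_norm_le_is_norm[OF assms]) blast
  have "g \<bullet> z \<le> norm g * M" if "N z \<le> 1" for z
  proof -
    have "norm z \<le> M"
      using M(2)[of z] mult_left_mono[OF that M(1)] by simp
    then show ?thesis
      using norm_cauchy_schwarz[of g z] mult_left_mono[of "norm z" M "norm g"] by simp
  qed
  then have bdd: "bdd_above ((\<bullet>) g ` {z. N z \<le> 1})"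
    by (intro bdd_aboveI2) auto
  have pos: "0 < N w"
    using False is_norm_ge_0[OF assms(2), of w] is_norm_eq_0[OF assms(2), of w] by simp
  then have "g \<bullet> (w /\<^sub>R N w) \<le> dual_norm N g"
    unfolding dual_norm_def
    by (intro cSUP_upper[OF _ bdd]) (simp add: is_norm_scale[OF assms(2)])
  then show ?thesis
    using pos by (simp add: field_simps)
qed (simp add: is_norm_zero[OF assms(2)])

lemma GDERIV_grad:
  fixes f :: "'a::real_inner \<Rightarrow> ereal"
  assumes "finite_dim TYPE('a)" "differentiable_fun f"
  shows "GDERIV (\<lambda>y. real_of_ereal (f y)) x :> grad f x"
proof -
  let ?\<phi> = "\<lambda>y. real_of_ereal (f y)"
  obtain L where L: "(?\<phi> has_derivative L) (at x)"
    using assms(2) unfolding differentiable_fun_def differentiable_def by blast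
  obtain D where D: "\<And>h. L h = h \<bullet> D"
    by (rule finite_dim_riesz[OF assms(1) has_derivative_linear[OF L]]) blast
  have "L = (\<lambda>h. h \<bullet> D)"
    using D by blast
  then have "GDERIV ?\<phi> x :> D"
    using L by (simp add: gderiv_def)
  moreover have "E = D" if "GDERIV ?\<phi> x :> E" for E
  proof -
    have "(\<lambda>h. h \<bullet> E) = L"
      using that L unfolding gderiv_def by (rule has_derivative_unique)
    then have "(E - D) \<bullet> E = (E - D) \<bullet> D"
      using D by metis
    then show ?thesis
      by (metis inner_diff_right inner_eq_zero_iff right_minus_eq)
  qed
  ultimately show ?thesis
    unfolding grad_def by (rule theI)
qed

text \<open>\<open>D \<bullet> h\<close> is the limit of the one-sided difference quotients along
  \<open>h\<close>, each at most \<open>c\<close>. This serves both the gradient inequality and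
  first-order optimality on a ball.\<close>

lemma GDERIV_inner_le:
  assumes "GDERIV \<phi> x :> D"
    and "\<And>u. 0 < u \<Longrightarrow> u \<le> 1 \<Longrightarrow> \<phi> (x + u *\<^sub>R h) \<le> \<phi> x + u * c"
  shows "D \<bullet> h \<le> c"
proof -
  have "((\<lambda>u::real. x + u *\<^sub>R h) has_derivative (\<lambda>u. u *\<^sub>R h)) (at 0)"
    by (auto intro!: derivative_eq_intros)
  moreover have "(\<phi> has_derivative (\<lambda>v. v \<bullet> D)) (at (x + 0 *\<^sub>R h))"
    using assms(1) by (simp add: gderiv_def)
  ultimately have "((\<lambda>u. \<phi> (x + u *\<^sub>R h)) has_derivative (\<lambda>u. (u *\<^sub>R h) \<bullet> D)) (at 0)"
    by (rule has_derivative_compose)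
  then have "((\<lambda>u. \<phi> (x + u *\<^sub>R h)) has_real_derivative D \<bullet> h) (at 0)"
    by (simp add: has_field_derivative_def inner_commute mult_commute_abs)
  then have "((\<lambda>u. (\<phi> (x + u *\<^sub>R h) - \<phi> x) / u) \<longlongrightarrow> D \<bullet> h) (at_right 0)"
    by (auto simp: DERIV_def intro: tendsto_mono[OF at_le])
  moreover have "\<forall>\<^sub>F u in at_right 0. (\<phi> (x + u *\<^sub>R h) - \<phi> x) / u \<le> c"
    using eventually_at_right_real[OF zero_less_one]
  proof eventually_elim
    case (elim u)
    then show ?case
      using assms(2)[of u] by (simp add: divide_le_eq algebra_simps)
  qed
  ultimately show ?thesis
    by (rule tendsto_upperbound) (rule trivial_limit_at_right_real)
qed

section \<open>Convexity, minimizers and segments in balls\<close>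

lemma convex_fun_le:
  assumes "convex_fun f" "f a = ereal p" "f b = ereal q" "0 \<le> u" "u \<le> 1"
  shows "f (a + u *\<^sub>R (b - a)) \<le> ereal (p + u * (q - p))"
proof -
  have "f ((1 - u) *\<^sub>R a + u *\<^sub>R b) \<le> ereal (1 - u) * f a + ereal u * f b"
    using assms(1,4,5) unfolding convex_fun_def by blast
  then show ?thesis
    using assms(2,3) by (simp add: algebra_simps)
qed

lemma convex_fun_grad_ineq:
  fixes f :: "'a::real_inner \<Rightarrow> ereal"
  assumes "finite_dim TYPE('a)" "differentiable_fun f" "convex_fun f"
    and "f a = ereal p" "f b = ereal q"
  shows "grad f a \<bullet> (b - a) \<le> q - p"
proof (rule GDERIV_inner_le[OF GDERIV_grad[OF assms(1,2)]])
  fix u :: real assume u: "0 < u" "u \<le> 1"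
  obtain r where r: "f (a + u *\<^sub>R (b - a)) = ereal r"
    using assms(2) unfolding differentiable_fun_def by (metis ereal_real')
  show "real_of_ereal (f (a + u *\<^sub>R (b - a))) \<le> real_of_ereal (f a) + u * (q - p)"
    using convex_fun_le[OF assms(3-5), of u] u r assms(4) by simp
qed

lemma argmin_onD:
  assumes "z \<in> argmin_on f S"
  shows argmin_on_mem: "z \<in> S" and argmin_on_le: "y \<in> S \<Longrightarrow> f z \<le> f y"
  using assms by (auto simp: argmin_on_def is_arg_min_def not_less)

lemma minimizers_iff: "z \<in> minimizers f \<longleftrightarrow> (\<forall>y. f z \<le> f y)"
  by (auto simp: minimizers_def argmin_on_def is_arg_min_def not_less)

lemma min_value_minimizer: "z \<in> minimizers f \<Longrightarrow> min_value f = f z"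
  unfolding min_value_def minimizers_iff
  by (intro antisym INF_lower INF_greatest) auto

lemma norm_ball_segment:
  assumes "is_norm N" "0 \<le> u" "N (a - c) + u * N (b - a) \<le> t"
  shows "a + u *\<^sub>R (b - a) \<in> norm_ball N c t"
  using is_norm_triangle[OF assms(1), of "a - c" "u *\<^sub>R (b - a)"] assms(2,3)
  by (simp add: norm_ball_def is_norm_scale[OF assms(1)] diff_add_eq)

subsection \<open>One step of the method\<close>

text \<open>From a point \<open>y\<close> strictly inside the ball, a small move towards
  \<open>xs\<close> would stay in the ball and, by convexity, strictly decrease
  \<open>f\<close>.\<close>

lemma broximal_step_boundary:
  assumes N: "is_norm N" and "convex_fun f"
    and y: "y \<in> argmin_on f (norm_ball N x t)"
    and fin: "f y = ereal q" "f xs = ereal m" and "m < q"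
  shows "N (y - x) = t"
proof (rule ccontr)
  assume "N (y - x) \<noteq> t"
  then have lt: "N (y - x) < t"
    using argmin_on_mem[OF y] by (simp add: norm_ball_def)
  have "xs \<noteq> y"
    using fin \<open>m < q\<close> by auto
  then have d: "0 < N (xs - y)"
    using is_norm_ge_0[OF N, of "xs - y"] is_norm_eq_0[OF N, of "xs - y"] by simp
  \<comment> \<open>The largest step up to 1 that the triangle inequality keeps in the ball.\<close>
  define u where "u = min 1 ((t - N (y - x)) / N (xs - y))"
  have u: "0 < u" "u \<le> 1" "u * N (xs - y) \<le> t - N (y - x)"
    using lt d by (auto simp: u_def min_def field_simps)
  then have "f y \<le> f (y + u *\<^sub>R (xs - y))"
    by (intro argmin_on_le[OF y] norm_ball_segment[OF N]) auto
  also have "\<dots> \<le> ereal (q + u * (m - q))"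
    using u by (intro convex_fun_le[OF assms(2) fin]) auto
  finally have "0 \<le> u * (m - q)"
    using fin by simp
  then show False
    using u(1) \<open>m < q\<close> by (simp add: zero_le_mult_iff)
qed

text \<open>Compare \<open>y\<close> with the point at distance \<open>t\<close> from
  \<open>x\<close> on the segment to \<open>xs\<close>: convexity contracts the gap by
  \<open>1 - t / r\<close>, where \<open>r\<close> is the distance from \<open>x\<close> to
  \<open>xs\<close>.\<close>

lemma broximal_step_gap:
  assumes N: "is_norm N" and "convex_fun f" and t: "0 < t"
    and y: "y \<in> argmin_on f (norm_ball N x t)"
    and fin: "f x = ereal p" "f y = ereal q" "f xs = ereal m" and "m \<le> p" "y \<noteq> xs"
  shows "q - m \<le> inverse (1 + t / N (y - xs)) * (p - m)"
proof -
  have d: "0 < N (y - xs)"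
    using \<open>y \<noteq> xs\<close> is_norm_ge_0[OF N, of "y - xs"] is_norm_eq_0[OF N, of "y - xs"] by simp
  show ?thesis
  proof (cases "N (xs - x) \<le> t")
    \<comment> \<open>Here \<open>xs\<close> itself competes in the ball, so the left side is at
      most 0.\<close>
    case True
    then have "f y \<le> f xs"
      by (intro argmin_on_le[OF y]) (simp add: norm_ball_def)
    then have "q - m \<le> 0"
      using fin by simp
    also have "0 \<le> inverse (1 + t / N (y - xs)) * (p - m)"
      using t d \<open>m \<le> p\<close> by simp
    finally show ?thesis .
  next
    case False
    define r where "r = N (xs - x)"
    have r: "t < r"
      using False by (simp add: r_def)
    have "f y \<le> f (x + (t / r) *\<^sub>R (xs - x))"
      using t r by (intro argmin_on_le[OF y] norm_ball_segment[OF N])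
        (auto simp: is_norm_zero[OF N] r_def)
    also have "\<dots> \<le> ereal (p + t / r * (m - p))"
      using t r by (intro convex_fun_le[OF assms(2) fin(1,3)]) auto
    finally have "q \<le> p + t / r * (m - p)"
      using fin by simp
    also have "\<dots> = (1 - t / r) * (p - m) + m"
      by (simp add: algebra_simps diff_divide_distrib)
    finally have "q - m \<le> (1 - t / r) * (p - m)"
      by simp
    also have "\<dots> \<le> inverse (1 + t / N (y - xs)) * (p - m)"
    proof (rule mult_right_mono)
      \<comment> \<open>Triangle inequality through \<open>y\<close>, which lies within
        \<open>t\<close> of \<open>x\<close>.\<close>
      have "r \<le> N (y - xs) + t"
        using is_norm_triangle[OF N, of "xs - y" "y - x"] argmin_on_mem[OF y]
          is_norm_minus_commute[OF N, of xs y]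
        by (auto simp: r_def norm_ball_def)
      then have "t / (N (y - xs) + t) \<le> t / r"
        using t r by (intro divide_left_mono) auto
      moreover have "inverse (1 + t / N (y - xs)) = 1 - t / (N (y - xs) + t)"
        using d t by (simp add: field_simps)
      ultimately show "1 - t / r \<le> inverse (1 + t / N (y - xs))"
        by simp
    qed (use \<open>m \<le> p\<close> in simp)
    finally show ?thesis .
  qed
qed

text \<open>First-order optimality of \<open>y\<close> on the ball, tested at \<open>x - t w\<close> with \<open>N w \<le> 1\<close>, gives
  \<open>t \<langle>grad f y, w\<rangle> \<le> \<langle>grad f y, x - y\<rangle>\<close>.\<close>

lemma broximal_step_dual_norm_descent:
  fixes f :: "'a::real_inner \<Rightarrow> ereal"
  assumes fd: "finite_dim TYPE('a)" and N: "is_norm N" and "convex_fun f"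
    and df: "differentiable_fun f" and t: "0 < t"
    and y: "y \<in> argmin_on f (norm_ball N x t)"
    and fin: "f x = ereal p" "f y = ereal q"
  shows "t * dual_norm N (grad f y) \<le> p - q"
proof -
  have "grad f y \<bullet> w \<le> (p - q) / t" if w: "N w \<le> 1" for w
  proof -
    define z where "z = x - t *\<^sub>R w"
    have z: "N (z - x) \<le> t"
      using w t by (simp add: z_def is_norm_minus[OF N] is_norm_scale[OF N] mult_left_le)
    \<comment> \<open>The sign is flipped so that minimality of \<open>y\<close> becomes an upper
      bound with \<open>c = 0\<close>.\<close>
    have "GDERIV (\<lambda>v. - real_of_ereal (f v)) y :> - grad f y"
      using GDERIV_grad[OF fd df] by (rule GDERIV_minus)
    then have "- grad f y \<bullet> (z - y) \<le> 0"
    proof (rule GDERIV_inner_le)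
      fix u :: real assume u: "0 < u" "u \<le> 1"
      \<comment> \<open>Convexity of the ball: the segment from \<open>y\<close> to \<open>z\<close>
        stays inside.\<close>
      have "N (y + u *\<^sub>R (z - y) - x) = N ((1 - u) *\<^sub>R (y - x) + u *\<^sub>R (z - x))"
        by (simp add: algebra_simps)
      also have "\<dots> \<le> (1 - u) * N (y - x) + u * N (z - x)"
        using is_norm_triangle[OF N, of "(1 - u) *\<^sub>R (y - x)" "u *\<^sub>R (z - x)"] u
        by (simp add: is_norm_scale[OF N])
      also have "\<dots> \<le> t"
        using u z argmin_on_mem[OF y] by (intro convex_bound_le) (auto simp: norm_ball_def)
      finally have "f y \<le> f (y + u *\<^sub>R (z - y))"
        by (intro argmin_on_le[OF y]) (simp add: norm_ball_def)
      moreover have "\<bar>f v\<bar> \<noteq> \<infinity>" for v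
        using df by (simp add: differentiable_fun_def)
      ultimately have "real_of_ereal (f y) \<le> real_of_ereal (f (y + u *\<^sub>R (z - y)))"
        by (metis ereal_less_eq(3) ereal_real')
      then show "- real_of_ereal (f (y + u *\<^sub>R (z - y))) \<le> - real_of_ereal (f y) + u * 0"
        by simp
    qed
    then have "t * (grad f y \<bullet> w) \<le> grad f y \<bullet> (x - y)"
      by (simp add: z_def inner_diff_right)
    also have "\<dots> \<le> p - q"
      by (rule convex_fun_grad_ineq[OF fd df assms(3) fin(2,1)])
    finally show ?thesis
      using t by (simp add: field_simps)
  qed
  then have "dual_norm N (grad f y) \<le> (p - q) / t"
    unfolding dual_norm_def
    by (intro cSUP_least) (auto intro: exI[of _ 0] simp: is_norm_zero[OF N])
  then show ?thesis
    using t by (simp add: field_simps)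
qed

lemma broximal_step_dual_norm_mono:
  fixes f :: "'a::real_inner \<Rightarrow> ereal"
  assumes fd: "finite_dim TYPE('a)" and N: "is_norm N" and cv: "convex_fun f"
    and df: "differentiable_fun f" and t: "0 < t"
    and y: "y \<in> argmin_on f (norm_ball N x t)"
    and fin: "f x = ereal p" "f y = ereal q"
  shows "dual_norm N (grad f y) \<le> dual_norm N (grad f x)"
proof -
  \<comment> \<open>Nonnegativity is what later allows \<open>N (x - y)\<close> to be replaced by
    \<open>t\<close>. For nonzero \<open>w\<close> it follows by adding the dual norm bounds for
    \<open>w\<close> and \<open>- w\<close>.\<close>
  have nonneg: "0 \<le> dual_norm N (grad f x)"
  proof (cases "\<exists>w::'a. w \<noteq> 0")
    case True
    then obtain w :: 'a where "w \<noteq> 0"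
      by blast
    then have "0 < N w"
      using is_norm_ge_0[OF N, of w] is_norm_eq_0[OF N, of w] by simp
    moreover have "0 \<le> dual_norm N (grad f x) * N w"
      using inner_le_dual_norm[OF fd N, of "grad f x" w]
        inner_le_dual_norm[OF fd N, of "grad f x" "- w"]
      unfolding is_norm_minus[OF N] inner_minus_right by linarith
    ultimately show ?thesis
      by (simp add: zero_le_mult_iff)
  next
    case False
    \<comment> \<open>In the zero space the supremum runs over the single value 0.\<close>
    then have "{z::'a. N z \<le> 1} = {0}" "grad f x = 0"
      by (auto simp: is_norm_zero[OF N])
    then show ?thesis
      by (simp add: dual_norm_def)
  qed
  have "t * dual_norm N (grad f y) \<le> p - q"
    by (rule broximal_step_dual_norm_descent[OF fd N cv df t y fin])
  also have "\<dots> \<le> grad f x \<bullet> (x - y)"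
    using convex_fun_grad_ineq[OF fd df cv fin] by (simp add: inner_diff_right)
  also have "\<dots> \<le> dual_norm N (grad f x) * N (x - y)"
    by (rule inner_le_dual_norm[OF fd N])
  also have "\<dots> \<le> dual_norm N (grad f x) * t"
    using argmin_on_mem[OF y] nonneg unfolding is_norm_minus_commute[OF N, of x y]
    by (intro mult_left_mono) (auto simp: norm_ball_def)
  finally show ?thesis
    using t by simp
qed

section \<open>The whole sequence of iterates\<close>

theorem theorem3:
  fixes N :: "'a::real_inner \<Rightarrow> real"
    and f :: "'a \<Rightarrow> ereal"
    and t :: "nat \<Rightarrow> real"
    and x :: "nat \<Rightarrow> 'a"
  assumes "finite_dim TYPE('a)"
    and "is_norm N"
    and "\<And>z. f z \<noteq> -\<infinity>"
    and "edom f \<noteq> {}"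
    and "closed_fun f"
    and "convex_fun f"
    and "minimizers f \<noteq> {}"
    and "\<And>k. 0 < t k"
    and "x 0 \<in> edom f"
    and "broximal_iterates N f t x"
  shows
    "(\<forall>k. minimizers f \<inter> norm_ball N (x k) (t k) \<noteq> {} \<longrightarrow> x (Suc k) \<in> minimizers f) \<and>
     (\<forall>k. minimizers f \<inter> norm_ball N (x k) (t k) = {} \<longrightarrow> N (x (Suc k) - x k) = t k) \<and>
     (\<forall>k. \<forall>xs\<in>minimizers f.
        f (x (Suc k)) - min_value f
          \<le> ereal (if x (Suc k) = xs then 0 else inverse (1 + t k / N (x (Suc k) - xs)))
              * (f (x k) - min_value f)) \<and>
     (differentiable_fun f \<longrightarrow>
        (\<forall>k. dual_norm N (grad f (x (Suc k))) \<le> dual_norm N (grad f (x k))) \<and>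
        (\<forall>K\<ge>1.
           ereal (\<Sum>k<K. t k / (\<Sum>j<K. t j) * dual_norm N (grad f (x (Suc k))))
             \<le> (f (x 0) - min_value f) / ereal (\<Sum>k<K. t k)))"
proof -
  note fd = assms(1) and N = assms(2) and cv = assms(6) and t = assms(8)
  have step: "x (Suc k) \<in> argmin_on f (norm_ball N (x k) (t k))" for k
    using assms(10) by (simp add: broximal_iterates_def)
  \<comment> \<open>The centre lies in its own ball; finiteness of \<open>f (x 0)\<close> thus
    passes to all iterates, and values can be treated as reals \<open>p k\<close>.\<close>
  have mono: "f (x (Suc k)) \<le> f (x k)" for k
    using t[of k] by (intro argmin_on_le[OF step]) (simp add: norm_ball_def is_norm_zero[OF N])
  have "f (x k) < \<infinity>" for k
  proof (induction k)
    case 0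
    then show ?case
      using assms(9) by (simp add: edom_def)
  next
    case (Suc k)
    then show ?case
      using mono[of k] by (rule le_less_trans[rotated])
  qed
  then have "\<exists>p. f (x k) = ereal p" for k
    using assms(3)[of "x k"] by (cases "f (x k)") (auto simp: less_le)
  then obtain p where p: "\<And>k. f (x k) = ereal (p k)"
    by metis
  obtain xs where xs: "xs \<in> minimizers f"
    using assms(7) by blast
  have "f xs \<le> f (x 0)"
    using xs by (simp add: minimizers_iff)
  then obtain m where m: "min_value f = ereal m"
    using min_value_minimizer[OF xs] assms(3)[of xs] p[of 0] by (cases "f xs") auto
  have fm: "f z = ereal m" if "z \<in> minimizers f" for z
    using min_value_minimizer[OF that] m by simp
  have mp: "m \<le> p k" for k
    using xs fm[OF xs] p[of k] by (metis ereal_less_eq(3) minimizers_iff)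
  have iff: "x k \<in> minimizers f \<longleftrightarrow> p k \<le> m" for k
    using xs fm p by (metis ereal_less_eq(3) minimizers_iff order_trans)

  have "x (Suc k) \<in> minimizers f"
    if "minimizers f \<inter> norm_ball N (x k) (t k) \<noteq> {}" for k
  proof -
    from that obtain z where z: "z \<in> minimizers f" "z \<in> norm_ball N (x k) (t k)"
      by blast
    then have "f (x (Suc k)) \<le> f z"
      by (intro argmin_on_le[OF step])
    then show ?thesis
      using fm[OF z(1)] p iff by simp
  qed
  moreover have "N (x (Suc k) - x k) = t k"
    if "minimizers f \<inter> norm_ball N (x k) (t k) = {}" for k
  proof -
    \<comment> \<open>The new iterate lies in the ball, which contains no minimizer.\<close>
    have "x (Suc k) \<notin> minimizers f"
      using that argmin_on_mem[OF step, of k] by blast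
    then have "m < p (Suc k)"
      using iff by simp
    then show ?thesis
      by (rule broximal_step_boundary[OF N cv step p fm[OF xs]])
  qed
  moreover have "f (x (Suc k)) - min_value f
      \<le> ereal (if x (Suc k) = xs then 0 else inverse (1 + t k / N (x (Suc k) - xs)))
          * (f (x k) - min_value f)" if "xs \<in> minimizers f" for k xs
  proof (cases "x (Suc k) = xs")
    case True
    then show ?thesis
      using fm[OF that] m p by simp
  next
    case False
    then show ?thesis
      using broximal_step_gap[OF N cv t step p p fm[OF that] mp False] m p by simp
  qed
  moreover have "dual_norm N (grad f (x (Suc k))) \<le> dual_norm N (grad f (x k))"
    if "differentiable_fun f" for k
    by (rule broximal_step_dual_norm_mono[OF fd N cv that t step p p])
  moreover have "ereal (\<Sum>k<K. t k / (\<Sum>j<K. t j) * dual_norm N (grad f (x (Suc k))))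
      \<le> (f (x 0) - min_value f) / ereal (\<Sum>k<K. t k)"
    if df: "differentiable_fun f" and K: "K \<ge> 1" for K
  proof -
    define T where "T = (\<Sum>k<K. t k)"
    have T: "0 < T"
      unfolding T_def using K t by (intro sum_pos) (auto simp: lessThan_empty_iff)
    \<comment> \<open>The per-step descent telescopes to \<open>p 0 - p K\<close>, and
      \<open>p K\<close> is at least \<open>m\<close>.\<close>
    have "(\<Sum>k<K. t k * dual_norm N (grad f (x (Suc k)))) \<le> (\<Sum>k<K. p k - p (Suc k))"
      by (intro sum_mono broximal_step_dual_norm_descent[OF fd N cv df t step p p])
    also have "\<dots> = p 0 - p K"
      by (rule sum_lessThan_telescope')
    also have "\<dots> \<le> p 0 - m"
      using mp by simp
    finally have "(\<Sum>k<K. t k * dual_norm N (grad f (x (Suc k)))) / T \<le> (p 0 - m) / T"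
      using T by (intro divide_right_mono) auto
    then show ?thesis
      using T by (simp add: m p sum_divide_distrib flip: T_def)
  qed
  ultimately show ?thesis
    by blast
qed

end
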